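(* Let $k,n,m\geq 2$ be integers with $n<m$ and $n,m$ coprime. Then the toric reflection group $W(k,n,m)$ is isomorphic to the $J$-group $J\begin{pmatrix} k & n & m \\ 1 & n & m\end{pmatrix}$. Under this isomorphism, the generators $x_1,\dots,x_n$ of $W(k,n,m)$ correspond to elements of the $J$-group which act by reflections in Achar and Aubert's representation.
   Context: Toric reflection group: for $k,n,m\ge 2$ with $n,m$ coprime, $W(k,n,m)$ is the group with generators $x_1,\dots,x_n$ and relations $x_i^k=1$ for $i=1,\dots,n$, and $x_1x_2\cdots x_m=x_ix_{i+1}\cdots x_{i+m-1}$ for $i=2,\dots,n$, indices of the $x_j$ being taken modulo $n$. $J$-groups: for integers $a,b,c\ge 2$, let $J\begin{pmatrix} a & b & c\\ & & \end{pmatrix}:=\langle s,t,u \mid s^a=t^b=u^c=1,\ stu=tus=ust\rangle$. If $a',b',c'$ are pairwise coprime positive integers with $a'\mid a$, $b'\mid b$, $c'\mid c$, then $J\begin{pmatrix} a & b & c\\ a' & b' & c'\end{pmatrix}$ is the normal closure of $\{s^{a'},t^{b'},u^{c'}\}$ in $J\begin{pmatrix} a & b & c\\ & & \end{pmatrix}$. A (pseudo-)reflection in $\mathrm{GL}_2(\mathbb{C})$ is an element of finite order whose space of fixed points is a hyperplane (a line) in $\mathbb{C}^2$. Achar and Aubert's representation of $G=J\begin{pmatrix} a & b & c\\ & & \end{pmatrix}$: let $K\subset\mathbb{C}$ be a finite abelian extension of $\mathbb{Q}$ containing the roots of unity of orders $2a,2b,2c$, with ring of algebraic integers $\mathbb{Z}_K$;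 let $\theta=e^{i\pi/a}$, $\phi=e^{i\pi/b}$, $\psi=e^{i\pi/c}$, and choose $q,r\in\mathbb{Z}_K$ with $qr=\theta\phi(\psi+\psi^{-1})-\theta^2-\phi^2$. Then $\rho(s)=\begin{pmatrix}\theta^2 & q\\ 0&1\end{pmatrix}$, $\rho(t)=\begin{pmatrix}1&0\\ r&\phi^2\end{pmatrix}$, $\rho(u)=\theta\phi\psi\,\rho(t)^{-1}\rho(s)^{-1}$ extends to a group homomorphism $\rho:G\to\mathrm{GL}_2(K)\subset \mathrm{GL}_2(\mathbb{C})$ (known result of Achar and Aubert). By restriction it gives a representation of every $J$-group $J\begin{pmatrix} a & b & c\\ a' & b' & c'\end{pmatrix}\subseteq G$; here $(a,b,c)=(k,n,m)$. *)

theory Defs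
  imports "HOL-Analysis.Analysis" "HOL-Algebra.Algebraic_Closure_Type"
begin

section \<open>Groups given by generators and relations\<close>

text \<open>A word is a list of letters; \<open>(x, True)\<close> stands for \<open>x\<close> and \<open>(x, False)\<close> for its inverse.\<close>

type_synonym 'a word = "('a \<times> bool) list"

definition words :: "'a set \<Rightarrow> 'a word set" where
  "words I = lists (I \<times> UNIV)"

abbreviation letter :: "'a \<Rightarrow> 'a \<times> bool" where
  "letter x \<equiv> (x, True)"

text \<open>A relation \<open>u = v\<close> is the pair \<open>(u, v)\<close>. The group presented by \<open>I\<close> and \<open>R\<close> consists of the
  words over \<open>I\<close> modulo the least congruence that contains \<open>R\<close> (pairs with letters outside
  \<open>I\<close> are ignored) and the free cancellations.\<close>

inductive_set pres_rel :: "'a set \<Rightarrow> ('a word \<times> 'a word) set \<Rightarrow> ('a word \<times> 'a word) set"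
  for I :: "'a set" and R :: "('a word \<times> 'a word) set" where
  refl: "w \<in> words I \<Longrightarrow> (w, w) \<in> pres_rel I R"
| sym: "(u, v) \<in> pres_rel I R \<Longrightarrow> (v, u) \<in> pres_rel I R"
| trans: "(u, v) \<in> pres_rel I R \<Longrightarrow> (v, w) \<in> pres_rel I R \<Longrightarrow> (u, w) \<in> pres_rel I R"
| app: "(u, u') \<in> pres_rel I R \<Longrightarrow> (v, v') \<in> pres_rel I R \<Longrightarrow> (u @ v, u' @ v') \<in> pres_rel I R"
| cancel: "x \<in> I \<Longrightarrow> ([(x, e), (x, \<not> e)], []) \<in> pres_rel I R"
| rel: "(u, v) \<in> R \<Longrightarrow> u \<in> words I \<Longrightarrow> v \<in> words I \<Longrightarrow> (u, v) \<in> pres_rel I R"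

definition presented :: "'a set \<Rightarrow> ('a word \<times> 'a word) set \<Rightarrow> 'a word set monoid" where
  "presented I R = \<lparr>
     carrier = words I // pres_rel I R,
     monoid.mult = (\<lambda>A B. \<Union>u\<in>A. \<Union>v\<in>B. pres_rel I R `` {u @ v}),
     one = pres_rel I R `` {[]}\<rparr>"

definition pres_gen :: "'a set \<Rightarrow> ('a word \<times> 'a word) set \<Rightarrow> 'a \<Rightarrow> 'a word set" where
  "pres_gen I R x = pres_rel I R `` {[letter x]}"

definition word_eval :: "('b, 'c) monoid_scheme \<Rightarrow> ('a \<Rightarrow> 'b) \<Rightarrow> 'a word \<Rightarrow> 'b" where
  "word_eval H f w =
     foldr (\<lambda>(x, e) h. (if e then f x else inv\<^bsub>H\<^esub> (f x)) \<otimes>\<^bsub>H\<^esub> h) w \<one>\<^bsub>H\<^esub>"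

lemma words_append [simp]: "u @ v \<in> words I \<longleftrightarrow> u \<in> words I \<and> v \<in> words I"
  by (auto simp: words_def)

lemma words_Nil [simp]: "[] \<in> words I"
  by (auto simp: words_def)

lemma words_Cons [simp]: "(x, e) # w \<in> words I \<longleftrightarrow> x \<in> I \<and> w \<in> words I"
  by (auto simp: words_def)

lemma pres_rel_in_words: "(u, v) \<in> pres_rel I R \<Longrightarrow> u \<in> words I \<and> v \<in> words I"
  by (induction rule: pres_rel.induct) auto

lemma equiv_pres_rel: "equiv (words I) (pres_rel I R)"
proof (rule equivI)
  show "pres_rel I R \<subseteq> words I \<times> words I"
    by (auto dest: pres_rel_in_words)
  show "refl_on (words I) (pres_rel I R)"
    by (simp add: refl_on_def pres_rel.refl)
  show "Relation.sym (pres_rel I R)"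
    by (intro symI) (rule pres_rel.sym)
  show "Relation.trans (pres_rel I R)"
    by (intro transI) (rule pres_rel.trans)
qed

lemma presented_mult:
  assumes "u \<in> words I" "v \<in> words I"
  shows "(pres_rel I R `` {u}) \<otimes>\<^bsub>presented I R\<^esub> (pres_rel I R `` {v}) = pres_rel I R `` {u @ v}"
proof -
  have *: "pres_rel I R `` {u' @ v'} = pres_rel I R `` {u @ v}"
    if "u' \<in> pres_rel I R `` {u}" "v' \<in> pres_rel I R `` {v}" for u' v'
    using that by (intro equiv_class_eq[OF equiv_pres_rel] pres_rel.sym[OF pres_rel.app]) simp_all
  have "u \<in> pres_rel I R `` {u}" "v \<in> pres_rel I R `` {v}"
    using assms by (simp_all add: pres_rel.refl)
  then have "(\<Union>u'\<in>pres_rel I R `` {u}. \<Union>v'\<in>pres_rel I R `` {v}. pres_rel I R `` {u' @ v'})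
      = pres_rel I R `` {u @ v}"
    using * by blast
  then show ?thesis
    by (simp add: presented_def)
qed

lemma pres_rel_inverse:
  assumes "w \<in> words I"
  shows "(map (\<lambda>(x, e). (x, \<not> e)) (rev w) @ w, []) \<in> pres_rel I R"
  using assms
proof (induction w)
  case Nil
  then show ?case by (auto intro: pres_rel.refl)
next
  case (Cons y w)
  obtain x e where y: "y = (x, e)" by (cases y)
  let ?i = "\<lambda>w. map (\<lambda>(x, e). (x, \<not> e)) (rev w)"
  have w: "x \<in> I" "w \<in> words I" using Cons.prems y by auto
  have iw: "?i w \<in> words I"
    using w(2) by (auto simp: words_def)
  have c: "([(x, \<not> e), (x, e)], []) \<in> pres_rel I R"
    using pres_rel.cancel[OF w(1), of "\<not> e"] by simp
  have "([(x, \<not> e), (x, e)] @ w, [] @ w) \<in> pres_rel I R"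
    by (rule pres_rel.app[OF c pres_rel.refl[OF w(2)]])
  then have "(?i w @ [(x, \<not> e), (x, e)] @ w, ?i w @ [] @ w) \<in> pres_rel I R"
    by (rule pres_rel.app[OF pres_rel.refl[OF iw]])
  then show ?case
    using Cons.IH[OF w(2)] y by (auto intro: pres_rel.trans)
qed

lemma group_presented: "group (presented I R)"
proof (rule groupI)
  let ?q = "\<lambda>w. pres_rel I R `` {w}"
  have car: "\<And>A. A \<in> carrier (presented I R) \<longleftrightarrow> (\<exists>w\<in>words I. A = ?q w)"
    by (auto simp: presented_def quotient_def)
  have one: "\<one>\<^bsub>presented I R\<^esub> = ?q []"
    by (simp add: presented_def)
  show "\<one>\<^bsub>presented I R\<^esub> \<in> carrier (presented I R)"
    unfolding car one using words_Nil by metis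
  fix A assume "A \<in> carrier (presented I R)"
  then obtain u where u: "u \<in> words I" "A = ?q u" using car by auto
  show "\<one>\<^bsub>presented I R\<^esub> \<otimes>\<^bsub>presented I R\<^esub> A = A"
    unfolding one u(2) by (simp only: presented_mult[OF words_Nil u(1)] append_Nil)
  let ?i = "map (\<lambda>(x, e). (x, \<not> e)) (rev u)"
  have i: "?i \<in> words I" using u(1) by (auto simp: words_def)
  have "?q ?i \<otimes>\<^bsub>presented I R\<^esub> A = \<one>\<^bsub>presented I R\<^esub>"
    unfolding one u(2) presented_mult[OF i u(1)]
    by (rule equiv_class_eq[OF equiv_pres_rel pres_rel_inverse[OF u(1)]])
  then show "\<exists>B\<in>carrier (presented I R). B \<otimes>\<^bsub>presented I R\<^esub> A = \<one>\<^bsub>presented I R\<^esub>"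
    using car i by blast
  fix B assume "B \<in> carrier (presented I R)"
  then obtain v where v: "v \<in> words I" "B = ?q v" using car by auto
  show "A \<otimes>\<^bsub>presented I R\<^esub> B \<in> carrier (presented I R)"
    unfolding car u(2) v(2) presented_mult[OF u(1) v(1)]
    using u(1) v(1) by (intro bexI[of _ "u @ v"]) auto
  fix C assume "C \<in> carrier (presented I R)"
  then obtain w where w: "w \<in> words I" "C = ?q w" using car by auto
  show "A \<otimes>\<^bsub>presented I R\<^esub> B \<otimes>\<^bsub>presented I R\<^esub> C
      = A \<otimes>\<^bsub>presented I R\<^esub> (B \<otimes>\<^bsub>presented I R\<^esub> C)"
    unfolding u(2) v(2) w(2) using u(1) v(1) w(1) by (simp only: presented_mult words_append append_assoc simp_thms)
qed

lemma word_eval_Nil [simp]: "word_eval H f [] = \<one>\<^bsub>H\<^esub>"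
  by (simp add: word_eval_def)

lemma word_eval_Cons [simp]:
  "word_eval H f ((x, e) # w) = (if e then f x else inv\<^bsub>H\<^esub> (f x)) \<otimes>\<^bsub>H\<^esub> word_eval H f w"
  by (simp add: word_eval_def)

lemma (in group) word_eval_closed:
  assumes f: "f \<in> I \<rightarrow> carrier G"
  shows "w \<in> words I \<Longrightarrow> word_eval G f w \<in> carrier G"
proof (induction w)
  case (Cons y w)
  obtain x e where y: "y = (x, e)" by (cases y)
  with Cons have "f x \<in> carrier G" "word_eval G f w \<in> carrier G" using funcset_mem[OF f] by auto
  then show ?case by (simp add: y)
qed simp

lemma (in group) word_eval_append:
  assumes f: "f \<in> I \<rightarrow> carrier G" and v: "v \<in> words I"
  shows "u \<in> words I \<Longrightarrow> word_eval G f (u @ v) = word_eval G f u \<otimes> word_eval G f v"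
proof (induction u)
  case Nil
  show ?case using word_eval_closed[OF f v] by simp
next
  case (Cons y u)
  obtain x e where y: "y = (x, e)" by (cases y)
  with Cons have "f x \<in> carrier G" "word_eval G f u \<in> carrier G" "word_eval G f v \<in> carrier G"
    "word_eval G f (u @ v) = word_eval G f u \<otimes> word_eval G f v"
    using funcset_mem[OF f] word_eval_closed[OF f] v by auto
  then show ?case by (simp add: y m_assoc)
qed

lemma (in group) word_eval_pres_rel:
  assumes f: "f \<in> I \<rightarrow> carrier G"
    and R: "\<And>u v. (u, v) \<in> R \<Longrightarrow> u \<in> words I \<Longrightarrow> v \<in> words I \<Longrightarrow> word_eval G f u = word_eval G f v"
    and "(u, v) \<in> pres_rel I R"
  shows "word_eval G f u = word_eval G f v"
  using assms(3)
proof (induction rule: pres_rel.induct)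
  case (app u u' v v')
  then show ?case
    using pres_rel_in_words[OF app(1)] pres_rel_in_words[OF app(2)] by (simp add: word_eval_append[OF f])
next
  case (cancel x e)
  then have "f x \<in> carrier G" using funcset_mem[OF f] by simp
  then show ?case by (cases e) simp_all
qed (use R in auto)

text \<open>The universal property of the presented group.\<close>

lemma (in group) presented_lift:
  assumes f: "f \<in> I \<rightarrow> carrier G"
    and R: "\<And>u v. (u, v) \<in> R \<Longrightarrow> u \<in> words I \<Longrightarrow> v \<in> words I \<Longrightarrow> word_eval G f u = word_eval G f v"
  shows "\<exists>h \<in> hom (presented I R) G. \<forall>x\<in>I. h (pres_gen I R x) = f x"
proof -
  let ?q = "\<lambda>w. pres_rel I R `` {w}"
  define h where "h A = word_eval G f (SOME w. w \<in> A)" for A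
  have h: "h (?q w) = word_eval G f w" if "w \<in> words I" for w
  proof -
    have "(SOME v. v \<in> ?q w) \<in> ?q w"
      using pres_rel.refl[OF that, of R] by (intro someI[of "\<lambda>v. v \<in> ?q w" w]) auto
    then have "(w, SOME v. v \<in> ?q w) \<in> pres_rel I R" by auto
    then show ?thesis unfolding h_def using word_eval_pres_rel[OF f R] by metis
  qed
  have car: "\<And>A. A \<in> carrier (presented I R) \<longleftrightarrow> (\<exists>w\<in>words I. A = ?q w)"
    by (auto simp: presented_def quotient_def)
  have "h \<in> hom (presented I R) G"
  proof (rule homI)
    fix A B assume "A \<in> carrier (presented I R)" "B \<in> carrier (presented I R)"
    then obtain u v where *: "u \<in> words I" "A = ?q u" "v \<in> words I" "B = ?q v" using car by auto
    show "h A \<in> carrier G" using * h word_eval_closed[OF f] by simp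
    show "h (A \<otimes>\<^bsub>presented I R\<^esub> B) = h A \<otimes> h B"
      using * by (simp add: presented_mult h word_eval_append[OF f])
  qed
  moreover have "h (pres_gen I R x) = f x" if "x \<in> I" for x
    using funcset_mem[OF f that] h[of "[letter x]"] that by (simp add: pres_gen_def)
  ultimately show ?thesis by blast
qed


section \<open>Toric reflection groups\<close>

text \<open>The representative in \<open>{1..n}\<close> of \<open>j\<close> modulo \<open>n\<close>, for \<open>j \<ge> 1\<close>.\<close>

definition wrap :: "nat \<Rightarrow> nat \<Rightarrow> nat" where
  "wrap n j = (j - 1) mod n + 1"

definition cyc_word :: "nat \<Rightarrow> nat \<Rightarrow> nat \<Rightarrow> nat word" where
  "cyc_word n m i = map (\<lambda>j. letter (wrap n j)) [i..<i + m]"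

definition toric_rels :: "nat \<Rightarrow> nat \<Rightarrow> nat \<Rightarrow> (nat word \<times> nat word) set" where
  "toric_rels k n m =
     {(replicate k (letter i), []) |i. i \<in> {1..n}} \<union>
     {(cyc_word n m 1, cyc_word n m i) |i. i \<in> {2..n}}"

definition toric_group :: "nat \<Rightarrow> nat \<Rightarrow> nat \<Rightarrow> nat word set monoid" where
  "toric_group k n m = presented {1..n} (toric_rels k n m)"

definition toric_gen :: "nat \<Rightarrow> nat \<Rightarrow> nat \<Rightarrow> nat \<Rightarrow> nat word set" where
  "toric_gen k n m i = pres_gen {1..n} (toric_rels k n m) i"


section \<open>J-groups\<close>

datatype stu = S | T | U

definition J_rels :: "nat \<Rightarrow> nat \<Rightarrow> nat \<Rightarrow> (stu word \<times> stu word) set" where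
  "J_rels a b c =
     {(replicate a (letter S), []), (replicate b (letter T), []), (replicate c (letter U), []),
      ([letter S, letter T, letter U], [letter T, letter U, letter S]),
      ([letter T, letter U, letter S], [letter U, letter S, letter T])}"

definition J_parent :: "nat \<Rightarrow> nat \<Rightarrow> nat \<Rightarrow> stu word set monoid" where
  "J_parent a b c = presented UNIV (J_rels a b c)"

definition J_gen :: "nat \<Rightarrow> nat \<Rightarrow> nat \<Rightarrow> stu \<Rightarrow> stu word set" where
  "J_gen a b c x = pres_gen UNIV (J_rels a b c) x"

definition normal_closure :: "('a, 'b) monoid_scheme \<Rightarrow> 'a set \<Rightarrow> 'a set" where
  "normal_closure G A = \<Inter>{N. N \<lhd> G \<and> A \<subseteq> N}"

definition J_group ::
  "nat \<Rightarrow> nat \<Rightarrow> nat \<Rightarrow> nat \<Rightarrow> nat \<Rightarrow> nat \<Rightarrow> stu word set monoid" where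
  "J_group a b c a' b' c' =
     (J_parent a b c)\<lparr>carrier := normal_closure (J_parent a b c)
        {J_gen a b c S [^]\<^bsub>J_parent a b c\<^esub> a',
         J_gen a b c T [^]\<^bsub>J_parent a b c\<^esub> b',
         J_gen a b c U [^]\<^bsub>J_parent a b c\<^esub> c'}\<rparr>"


section \<open>Reflections\<close>

definition GL2 :: "complex set \<Rightarrow> (complex^2^2) monoid" where
  "GL2 K = \<lparr>carrier = {A. invertible A \<and> (\<forall>i j. A $ i $ j \<in> K)},
            monoid.mult = (**), one = mat 1\<rparr>"

definition is_reflection :: "complex^2^2 \<Rightarrow> bool" where
  "is_reflection A \<longleftrightarrow>
     A \<in> carrier (GL2 UNIV) \<and> (\<exists>d::nat. d > 0 \<and> A [^]\<^bsub>GL2 UNIV\<^esub> d = \<one>\<^bsub>GL2 UNIV\<^esub>) \<and>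
     vec.dim {v. A *v v = v} = 1"


section \<open>The representation of Achar and Aubert\<close>

definition complex_ring :: "complex ring" where
  "complex_ring = ring_of_type_algebra"

definition field_auts :: "complex set \<Rightarrow> (complex \<Rightarrow> complex) set" where
  "field_auts K = ring_iso (complex_ring\<lparr>carrier := K\<rparr>) (complex_ring\<lparr>carrier := K\<rparr>)"

text \<open>Every automorphism of a number field fixes the rationals, so an extension of the rationals is
  Galois when the rationals are the only elements fixed by all its automorphisms. The members
  of \<open>field_auts K\<close> are only determined on \<open>K\<close>, so they are compared there.\<close>

definition finite_abelian_extension :: "complex set \<Rightarrow> bool" where
  "finite_abelian_extension K \<longleftrightarrow>
     subfield K complex_ring \<and> ring.finite_dimension complex_ring \<rat> K \<and>
     {x \<in> K. \<forall>\<sigma>\<in>field_auts K. \<sigma> x = x} = \<rat> \<and>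
     (\<forall>\<sigma>\<in>field_auts K. \<forall>\<tau>\<in>field_auts K. \<forall>x\<in>K. \<sigma> (\<tau> x) = \<tau> (\<sigma> x))"

definition integer_ring :: "complex set \<Rightarrow> complex set" where
  "integer_ring K = {x \<in> K. algebraic_int x}"

definition AA_root :: "nat \<Rightarrow> complex" where
  "AA_root a = exp (\<i> * of_real pi / of_nat a)"

definition AA_params ::
  "complex set \<Rightarrow> nat \<Rightarrow> nat \<Rightarrow> nat \<Rightarrow> complex \<Rightarrow> complex \<Rightarrow> bool" where
  "AA_params K a b c q r \<longleftrightarrow>
     finite_abelian_extension K \<and>
     {z. z ^ (2 * a) = 1} \<union> {z. z ^ (2 * b) = 1} \<union> {z. z ^ (2 * c) = 1} \<subseteq> K \<and>
     q \<in> integer_ring K \<and> r \<in> integer_ring K \<and>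
     (let \<theta> = AA_root a; \<phi> = AA_root b; \<psi> = AA_root c
      in q * r = \<theta> * \<phi> * (\<psi> + inverse \<psi>) - \<theta>\<^sup>2 - \<phi>\<^sup>2)"

definition AA_S :: "nat \<Rightarrow> complex \<Rightarrow> complex^2^2" where
  "AA_S a q = vector [vector [(AA_root a)\<^sup>2, q], vector [0, 1]]"

definition AA_T :: "nat \<Rightarrow> complex \<Rightarrow> complex^2^2" where
  "AA_T b r = vector [vector [1, 0], vector [r, (AA_root b)\<^sup>2]]"

definition AA_U :: "nat \<Rightarrow> nat \<Rightarrow> nat \<Rightarrow> complex \<Rightarrow> complex \<Rightarrow> complex^2^2" where
  "AA_U a b c q r =
     mat (AA_root a * AA_root b * AA_root c) ** (matrix_inv (AA_T b r) ** matrix_inv (AA_S a q))"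

text \<open>The three values determine \<open>\<rho>\<close> on the group; that they extend to a homomorphism is the result
  of Achar and Aubert.\<close>

definition AA_rep ::
  "complex set \<Rightarrow> nat \<Rightarrow> nat \<Rightarrow> nat \<Rightarrow> complex \<Rightarrow> complex \<Rightarrow> (stu word set \<Rightarrow> complex^2^2) \<Rightarrow> bool" where
  "AA_rep K a b c q r \<rho> \<longleftrightarrow>
     AA_params K a b c q r \<and> \<rho> \<in> hom (J_parent a b c) (GL2 K) \<and>
     \<rho> (J_gen a b c S) = AA_S a q \<and>
     \<rho> (J_gen a b c T) = AA_T b r \<and>
     \<rho> (J_gen a b c U) = AA_U a b c q r"

end

theory Submission
  imports Defs "HOL-Algebra.Bij"
begin

text \<open>Let \<open>s, t, u\<close> generate the parent \<open>J\<close>-group and let \<open>z = s t u\<close>, which is central. Since \<open>s t\<close> is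
  \<open>z\<close> times the inverse of \<open>u\<close>, we have \<open>(s t)^m = z^m\<close>, so the conjugates \<open>x_i = t^(i-1) s t^(1-i)\<close>
  satisfy \<open>x_i \<dots> x_(i+m-1) = z^m t^(-m)\<close> for every \<open>i\<close>. This gives a homomorphism from the toric group
  \<open>W\<close>, whose image is the normal closure of \<open>s\<close>. For injectivity, let \<open>\<delta> = x_1 \<dots> x_m\<close> in \<open>W\<close> and let \<open>\<sigma>\<close>
  be the automorphism shifting the generators. Let \<open>s\<close> act on \<open>W\<close> by left multiplication with \<open>x_1\<close>
  and \<open>t\<close> by \<open>\<sigma>\<close>. As \<open>\<delta> \<sigma>^m(v) = v \<delta>\<close>, the power \<open>(s t)^m\<close> acts as right multiplication by \<open>\<delta>\<close>, and
  on \<open>m\<close> copies of \<open>W\<close> this permutation has an \<open>m\<close>-th root \<open>\<zeta>\<close> commuting with \<open>s\<close> and \<open>t\<close>. Letting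
  \<open>u\<close> act as \<open>(s t)^(-1) \<zeta>\<close> defines an action of the parent group in which the image of \<open>W\<close> acts by left
  multiplication, hence faithfully.\<close>

section \<open>Words and homomorphisms of presented groups\<close>

lemma presented_carrierE:
  assumes "A \<in> carrier (presented I R)"
  obtains w where "w \<in> words I" "A = pres_rel I R `` {w}"
  using assms by (auto simp: presented_def quotient_def)

lemma pres_class_closed: "w \<in> words I \<Longrightarrow> pres_rel I R `` {w} \<in> carrier (presented I R)"
  by (auto simp: presented_def quotient_def)

lemma pres_gen_closed: "x \<in> I \<Longrightarrow> pres_gen I R x \<in> carrier (presented I R)"
  unfolding pres_gen_def by (rule pres_class_closed) simp

lemma inv_pres_gen:
  assumes "x \<in> I"
  shows "inv\<^bsub>presented I R\<^esub> (pres_gen I R x) = pres_rel I R `` {[(x, False)]}"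
proof -
  interpret P: group "presented I R" by (rule group_presented)
  have "(pres_rel I R `` {[(x, False)]}) \<otimes>\<^bsub>presented I R\<^esub> pres_gen I R x = pres_rel I R `` {[(x, False), (x, True)]}"
    unfolding pres_gen_def by (subst presented_mult) (use assms in auto)
  also have "\<dots> = \<one>\<^bsub>presented I R\<^esub>"
    using equiv_class_eq[OF equiv_pres_rel pres_rel.cancel[OF assms, of False]]
    by (simp add: presented_def)
  finally show ?thesis
    by (intro P.inv_equality) (use assms in \<open>auto intro: pres_gen_closed pres_class_closed\<close>)
qed

text \<open>Every element of a presented group is thereby the value of a word at the generators,
  which reduces claims about arbitrary elements to inductions over words.\<close>

lemma word_eval_pres_gen:
  "w \<in> words I \<Longrightarrow> word_eval (presented I R) (pres_gen I R) w = pres_rel I R `` {w}"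
proof (induction w)
  case Nil
  then show ?case by (simp add: presented_def)
next
  case (Cons y w)
  obtain x e where y: "y = (x, e)" by (cases y)
  have "(if e then pres_gen I R x else inv\<^bsub>presented I R\<^esub> (pres_gen I R x)) = pres_rel I R `` {[(x, e)]}"
    using Cons.prems y by (cases e) (simp_all add: inv_pres_gen, simp add: pres_gen_def)
  then show ?case
    using Cons y by (simp add: presented_mult)
qed

lemma presented_rel:
  assumes "(u, v) \<in> R" "u \<in> words I" "v \<in> words I"
  shows "word_eval (presented I R) (pres_gen I R) u = word_eval (presented I R) (pres_gen I R) v"
  using assms equiv_class_eq[OF equiv_pres_rel pres_rel.rel[OF assms]]
  by (simp add: word_eval_pres_gen)

lemma word_eval_cong:
  "w \<in> words I \<Longrightarrow> (\<And>x. x \<in> I \<Longrightarrow> f x = g x) \<Longrightarrow> word_eval H f w = word_eval H g w"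
  by (induction w) auto

lemma (in group_hom) hom_word_eval:
  assumes f: "f \<in> I \<rightarrow> carrier G"
  shows "w \<in> words I \<Longrightarrow> h (word_eval G f w) = word_eval H (\<lambda>x. h (f x)) w"
proof (induction w)
  case (Cons y w)
  obtain x e where y: "y = (x, e)" by (cases y)
  with Cons.prems have x: "f x \<in> carrier G" and w: "word_eval G f w \<in> carrier G"
    using funcset_mem[OF f] G.word_eval_closed[OF f] by auto
  show ?case
    using Cons x w y by (cases e) auto
qed simp

lemma (in group) presented_hom_eqI:
  assumes "h \<in> hom (presented I R) G" "h' \<in> hom (presented I R) G"
    and "\<And>x. x \<in> I \<Longrightarrow> h (pres_gen I R x) = h' (pres_gen I R x)"
    and "A \<in> carrier (presented I R)"
  shows "h A = h' A"
proof -
  interpret h: group_hom "presented I R" G h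
    using assms(1) group_presented is_group by (simp add: group_hom_def group_hom_axioms_def)
  interpret h': group_hom "presented I R" G h'
    using assms(2) group_presented is_group by (simp add: group_hom_def group_hom_axioms_def)
  obtain w where w: "w \<in> words I" "A = word_eval (presented I R) (pres_gen I R) w"
    using assms(4) by (metis presented_carrierE word_eval_pres_gen)
  have g: "pres_gen I R \<in> I \<rightarrow> carrier (presented I R)"
    by (auto intro: pres_gen_closed)
  show ?thesis
    unfolding w(2) h.hom_word_eval[OF g w(1)] h'.hom_word_eval[OF g w(1)]
    by (rule word_eval_cong[OF w(1) assms(3)])
qed

lemma (in group) word_eval_replicate:
  assumes "f x \<in> carrier G"
  shows "word_eval G f (replicate l (letter x)) = f x [^] l"
  by (induction l) (use assms nat_pow_Suc2 in auto)

lemma (in group) pow_mod_eq: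
  assumes "b \<in> carrier G" "b [^] (n::nat) = \<one>"
  shows "b [^] (i mod n) = b [^] i"
proof -
  have "b [^] i = b [^] (n * (i div n) + i mod n)" by simp
  also have "\<dots> = b [^] (n * (i div n)) \<otimes> b [^] (i mod n)"
    using assms(1) by (simp add: nat_pow_mult)
  also have "b [^] (n * (i div n)) = (b [^] n) [^] (i div n)"
    using assms(1) by (simp add: nat_pow_pow)
  finally show ?thesis using assms by simp
qed

section \<open>Conjugation and telescoping products\<close>

definition conj_by :: "('a, 'b) monoid_scheme \<Rightarrow> 'a \<Rightarrow> 'a \<Rightarrow> 'a" where
  "conj_by G g x = g \<otimes>\<^bsub>G\<^esub> x \<otimes>\<^bsub>G\<^esub> inv\<^bsub>G\<^esub> g"

context group
begin

lemma inv_cancel_left: "x \<in> carrier G \<Longrightarrow> y \<in> carrier G \<Longrightarrow> x \<otimes> (inv x \<otimes> y) = y"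
  by (simp flip: m_assoc)

lemma conj_by_closed [simp]:
  "g \<in> carrier G \<Longrightarrow> x \<in> carrier G \<Longrightarrow> conj_by G g x \<in> carrier G"
  by (simp add: conj_by_def)

lemma conj_by_one [simp]: "x \<in> carrier G \<Longrightarrow> conj_by G \<one> x = x"
  by (simp add: conj_by_def)

lemma conj_by_conj_by:
  assumes "g \<in> carrier G" "g' \<in> carrier G" "x \<in> carrier G"
  shows "conj_by G g (conj_by G g' x) = conj_by G (g \<otimes> g') x"
  using assms by (simp add: conj_by_def m_assoc inv_mult_group)

lemma conj_by_hom: "g \<in> carrier G \<Longrightarrow> conj_by G g \<in> hom G G"
  by (rule homI) (simp_all add: conj_by_def m_assoc inv_solve_left)

lemma conj_by_group_hom: "g \<in> carrier G \<Longrightarrow> group_hom G G (conj_by G g)"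
  using conj_by_hom is_group by (simp add: group_hom_def group_hom_axioms_def)

lemma conj_by_pow:
  assumes "g \<in> carrier G" "x \<in> carrier G"
  shows "conj_by G g x [^] (i::nat) = conj_by G g (x [^] i)"
  using group_hom.hom_nat_pow[OF conj_by_group_hom[OF assms(1)] assms(2)] by simp

lemma conj_by_commute:
  assumes "g \<in> carrier G" "x \<in> carrier G" "x \<otimes> g = g \<otimes> x"
  shows "conj_by G g x = x"
  using assms by (simp add: conj_by_def m_assoc flip: assms(3))

text \<open>The factors telescope: b^(j-1) a b^(1-j) followed by b^j a b^(-j) leaves a single
  \<open>b\<close> between the two copies of \<open>a\<close>. The relabelling \<open>c\<close>
  allows letters to be taken modulo n.\<close>

lemma word_eval_conj_product:
  assumes ab: "a \<in> carrier G" "b \<in> carrier G"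
    and f: "\<And>j. j \<ge> 1 \<Longrightarrow> f (c j) = conj_by G (b [^] (j - 1)) a" and "i \<ge> 1"
  shows "word_eval G f (map (\<lambda>j. letter (c j)) [i..<i + l])
    = b [^] (i - 1) \<otimes> (a \<otimes> b) [^] l \<otimes> inv (b [^] (i - 1 + l))"
proof (induction l)
  case (Suc l)
  let ?I = "c ` {1..}" and ?w = "map (\<lambda>j. letter (c j)) [i..<i + l]"
  have fI: "f \<in> ?I \<rightarrow> carrier G" using ab f by auto
  have w: "?w \<in> words ?I" "[letter (c (i + l))] \<in> words ?I"
    using \<open>i \<ge> 1\<close> by (auto simp: words_def)
  define d where "d = b [^] (i - 1 + l)"
  have d: "d \<in> carrier G" "b \<otimes> inv (d \<otimes> b) = inv d"
    using ab by (auto simp: d_def inv_mult_group m_assoc[symmetric])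
  have "f (c (i + l)) = d \<otimes> a \<otimes> inv d"
    using f[of "i + l"] \<open>i \<ge> 1\<close> by (simp add: conj_by_def d_def)
  then have e: "word_eval G f [letter (c (i + l))] = d \<otimes> a \<otimes> inv d"
    using ab d by simp
  have "word_eval G f (map (\<lambda>j. letter (c j)) [i..<i + Suc l])
      = word_eval G f ?w \<otimes> word_eval G f [letter (c (i + l))]"
    using word_eval_append[OF fI w(2,1)] by simp
  also have "\<dots> = b [^] (i - 1) \<otimes> (a \<otimes> b) [^] l \<otimes> inv d \<otimes> (d \<otimes> a \<otimes> inv d)"
    unfolding Suc.IH e d_def ..
  also have "\<dots> = b [^] (i - 1) \<otimes> (a \<otimes> b) [^] l \<otimes> (a \<otimes> inv d)"
    using ab d by (simp add: m_assoc inv_solve_left')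
  also have "\<dots> = b [^] (i - 1) \<otimes> (a \<otimes> b) [^] Suc l \<otimes> inv (d \<otimes> b)"
    using ab d by (simp add: m_assoc)
  finally show ?case by (simp add: d_def)
qed (use ab in simp)

end

section \<open>Cyclic words with indices modulo n\<close>

lemma wrap_mem: "n > 0 \<Longrightarrow> wrap n j \<in> {1..n}"
  using mod_less_divisor[of n "j - 1"] by (auto simp: wrap_def Suc_leI)

lemma wrap_id: "i \<in> {1..n} \<Longrightarrow> wrap n i = i"
  by (auto simp: wrap_def)

lemma wrap_wrap_add: "j \<ge> 1 \<Longrightarrow> wrap n (wrap n j + l) = wrap n (j + l)"
  by (simp add: wrap_def mod_add_left_eq)

lemma cyc_word_in_words: "n > 0 \<Longrightarrow> cyc_word n m i \<in> words {1..n}"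
  using wrap_mem by (auto simp: cyc_word_def words_def)

lemma cyc_word_wrap:
  assumes "i \<ge> 1"
  shows "cyc_word n m (wrap n i) = cyc_word n m i"
  by (rule nth_equalityI) (use assms in \<open>auto simp: cyc_word_def wrap_wrap_add\<close>)

text \<open>As \<open>b [^] n = \<one>\<close>, conjugation by a power of \<open>b\<close> depends
  on the exponent modulo \<open>n\<close> only, so the wrapped letters fit the telescoping
  formula.\<close>

lemma (in group) word_eval_cyc_word_conj:
  assumes "a \<in> carrier G" "b \<in> carrier G" "b [^] n = \<one>" "i \<ge> 1"
  shows "word_eval G (\<lambda>i. conj_by G (b [^] (i - 1)) a) (cyc_word n m i)
    = b [^] (i - 1) \<otimes> (a \<otimes> b) [^] m \<otimes> inv (b [^] (i - 1 + m))"
  unfolding cyc_word_def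
  by (rule word_eval_conj_product) (use assms in \<open>auto simp: wrap_def pow_mod_eq\<close>)

text \<open>If (a b)^m commutes with \<open>b\<close>, the outer powers of \<open>b\<close> cancel
  and \<open>i\<close> disappears from the value. This is the source of the toric relations among
  the conjugates.\<close>

lemma (in group) word_eval_cyc_word_conj_central:
  assumes ab: "a \<in> carrier G" "b \<in> carrier G" "b [^] n = \<one>" "i \<ge> 1"
    and c: "(a \<otimes> b) [^] m \<otimes> b = b \<otimes> (a \<otimes> b) [^] m"
  shows "word_eval G (\<lambda>i. conj_by G (b [^] (i - 1)) a) (cyc_word n m i)
    = (a \<otimes> b) [^] m \<otimes> inv (b [^] m)"
proof -
  define c where "c = (a \<otimes> b) [^] m"
  have cc: "c \<in> carrier G" using ab by (simp add: c_def)
  have "c \<otimes> b [^] (i - 1) = b [^] (i - 1) \<otimes> c"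
    using group_commutes_pow[of b c "i - 1"] ab cc c by (simp add: c_def)
  then have "b [^] (i - 1) \<otimes> c \<otimes> inv (b [^] (i - 1 + m)) = c \<otimes> b [^] (i - 1) \<otimes> inv (b [^] m \<otimes> b [^] (i - 1))"
    using ab(2) by (simp add: nat_pow_mult add.commute)
  also have "\<dots> = c \<otimes> inv (b [^] m)"
    using ab cc by (simp add: inv_mult_group m_assoc inv_cancel_left)
  finally show ?thesis
    unfolding word_eval_cyc_word_conj[OF ab] c_def .
qed

lemma (in group) toric_rels_conj:
  assumes ab: "a \<in> carrier G" "b \<in> carrier G" "a [^] k = \<one>" "b [^] n = \<one>"
    and c: "(a \<otimes> b) [^] m \<otimes> b = b \<otimes> (a \<otimes> b) [^] m"
    and "(u, v) \<in> toric_rels k n m"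
  shows "word_eval G (\<lambda>i. conj_by G (b [^] (i - 1)) a) u
    = word_eval G (\<lambda>i. conj_by G (b [^] (i - 1)) a) v"
  using assms(6) unfolding toric_rels_def
proof (elim UnE CollectE exE conjE)
  fix i assume "(u, v) = (replicate k (letter i), [])"
  moreover have "conj_by G (b [^] (i - 1)) \<one> = \<one>"
    using ab by (simp add: conj_by_def)
  ultimately show ?thesis
    using ab by (simp add: word_eval_replicate conj_by_pow)
next
  fix i assume "(u, v) = (cyc_word n m 1, cyc_word n m i)" "i \<in> {2..n}"
  then show ?thesis
    using word_eval_cyc_word_conj_central[OF ab(1,2,4) _ c] by simp
qed


section \<open>Homomorphisms out of the parent J-group\<close>

lemma (in group) commute_inv:
  assumes "x \<in> carrier G" "y \<in> carrier G" "x \<otimes> y = y \<otimes> x"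
  shows "x \<otimes> inv y = inv y \<otimes> x"
  using assms by (metis inv_solve_left inv_solve_right' m_assoc m_closed inv_closed)

text \<open>The missing generator \<open>U\<close> goes to
  \<open>inv (a \<otimes> b) \<otimes> z\<close>, which makes \<open>z\<close> the common value of
  the three rotated products. Its m-th power is trivial because \<open>z\<close> commutes with
  \<open>a \<otimes> b\<close> and both have the same m-th power.\<close>

lemma (in group) J_parent_lift:
  assumes abz: "a \<in> carrier G" "b \<in> carrier G" "z \<in> carrier G"
    and pow: "a [^] k = \<one>" "b [^] n = \<one>" "(a \<otimes> b) [^] m = z [^] m"
    and comm: "z \<otimes> a = a \<otimes> z" "z \<otimes> b = b \<otimes> z"
  shows "\<exists>h \<in> hom (J_parent k n m) G. h (J_gen k n m S) = a \<and> h (J_gen k n m T) = b"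
proof -
  define p where "p = a \<otimes> b"
  have p: "p \<in> carrier G" using abz by (simp add: p_def)
  have zp: "z \<otimes> p = p \<otimes> z"
    unfolding p_def using abz comm by (metis m_assoc)
  have zp': "z \<otimes> inv p = inv p \<otimes> z"
    by (rule commute_inv[OF abz(3) p zp])
  define f where "f = case_stu a b (inv p \<otimes> z)"
  have f: "f S = a" "f T = b" "f U = inv p \<otimes> z" by (simp_all add: f_def)
  have "(inv p \<otimes> z) [^] m = inv p [^] m \<otimes> z [^] m"
    using pow_mult_distrib[OF zp'[symmetric]] p abz(3) by simp
  also have "\<dots> = \<one>"
    using pow(3) p abz(3) by (simp add: nat_pow_inv flip: p_def)
  finally have um: "(inv p \<otimes> z) [^] m = \<one>" .
  have stu: "a \<otimes> (b \<otimes> (inv p \<otimes> z)) = z"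
    using p abz inv_cancel_left[OF p abz(3)] unfolding p_def by (simp add: m_assoc)
  have tus: "b \<otimes> (inv p \<otimes> z \<otimes> a) = z"
  proof -
    \<comment> \<open>Compare after multiplying by \<open>a\<close> on the left: since
      \<open>z\<close> commutes with \<open>a\<close>, both sides become
      \<open>a \<otimes> z\<close>, and \<open>a\<close> cancels.\<close>
    have "a \<otimes> (b \<otimes> (inv p \<otimes> z \<otimes> a)) = a \<otimes> (b \<otimes> (inv p \<otimes> z)) \<otimes> a"
      using p abz by (simp add: m_assoc)
    also have "\<dots> = a \<otimes> z" using stu comm by simp
    finally show ?thesis using p abz by simp
  qed
  have ust: "inv p \<otimes> z \<otimes> (a \<otimes> b) = z"
    using p abz zp inv_cancel_left[of "inv p" z] by (simp add: m_assoc flip: p_def)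
  have fI: "f \<in> UNIV \<rightarrow> carrier G"
    using p abz by (auto simp: f_def split: stu.split)
  have "\<exists>h \<in> hom (presented UNIV (J_rels k n m)) G. \<forall>x\<in>UNIV. h (pres_gen UNIV (J_rels k n m) x) = f x"
    by (rule presented_lift[OF fI])
      (use p abz pow um stu tus ust in \<open>auto simp: J_rels_def f word_eval_replicate\<close>)
  then show ?thesis
    unfolding J_parent_def J_gen_def using f by auto
qed

lemma word_eval_map_apfst:
  "word_eval H f (map (apfst p) w) = word_eval H (\<lambda>i. f (p i)) w"
  by (induction w) auto

lemma cyc_word_shift:
  "i \<ge> 1 \<Longrightarrow> map (apfst (\<lambda>j. wrap n (j + 1))) (cyc_word n m i) = cyc_word n m (i + 1)"
  unfolding cyc_word_def using wrap_wrap_add[of _ n 1] by (simp flip: map_Suc_upt del: upt_Suc)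

section \<open>Groups of permutations\<close>

lemma restrict_Bij: "bij_betw g Y Y \<Longrightarrow> (\<lambda>x\<in>Y. g x) \<in> Bij Y"
  by (simp add: Bij_def)

lemma BijGroup_mult_apply:
  "g \<in> Bij Y \<Longrightarrow> f \<in> Bij Y \<Longrightarrow> x \<in> Y \<Longrightarrow> (g \<otimes>\<^bsub>BijGroup Y\<^esub> f) x = g (f x)"
  by (simp add: BijGroup_def compose_def)

lemma BijGroup_eqI:
  "g \<in> Bij Y \<Longrightarrow> f \<in> Bij Y \<Longrightarrow> (\<And>x. x \<in> Y \<Longrightarrow> g x = f x) \<Longrightarrow> g = f"
  by (auto simp: Bij_def intro: extensionalityI)

lemma carrier_BijGroup: "carrier (BijGroup Y) = Bij Y"
  by (simp add: BijGroup_def)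

lemma one_BijGroup_apply: "x \<in> Y \<Longrightarrow> \<one>\<^bsub>BijGroup Y\<^esub> x = x"
  by (simp add: BijGroup_def)

lemma BijGroup_pow_apply:
  assumes "g \<in> Bij Y" "x \<in> Y"
  shows "(g [^]\<^bsub>BijGroup Y\<^esub> (i::nat)) x = (g ^^ i) x"
  using assms(2)
proof (induction i arbitrary: x)
  case 0
  then show ?case by (simp add: one_BijGroup_apply)
next
  case (Suc i)
  interpret B: group "BijGroup Y" by (rule group_BijGroup)
  have "g x \<in> Y" using assms(1) Suc.prems by (auto simp: Bij_def bij_betw_def)
  moreover have "g [^]\<^bsub>BijGroup Y\<^esub> i \<in> Bij Y"
    using B.nat_pow_closed assms(1) by (simp add: carrier_BijGroup)
  ultimately show ?case
    using Suc assms(1) by (simp add: BijGroup_mult_apply funpow_swap1)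
qed

section \<open>The toric group and its shift automorphism\<close>

locale toric_params =
  fixes k n m :: nat
  assumes pos: "k > 0" "n > 0" "m > 0"
begin

abbreviation W where "W \<equiv> toric_group k n m"
abbreviation J where "J \<equiv> J_parent k n m"

sublocale W: group W
  unfolding toric_group_def by (rule group_presented)

sublocale J: group J
  unfolding J_parent_def by (rule group_presented)

lemma toric_gen_eq: "toric_gen k n m = pres_gen {1..n} (toric_rels k n m)"
  by (simp add: fun_eq_iff toric_gen_def)

lemma toric_gen_closed [simp]: "i \<in> {1..n} \<Longrightarrow> toric_gen k n m i \<in> carrier W"
  unfolding toric_gen_def toric_group_def by (rule pres_gen_closed)

lemma toric_gen_funcset: "toric_gen k n m \<in> {1..n} \<rightarrow> carrier W"
  using toric_gen_closed by blast

text \<open>Indexing by all naturals avoids case distinctions at the seam between \<open>n\<close>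
  and 1. By truncated subtraction \<open>gen 0\<close> is \<open>gen 1\<close>, hence the bound
  \<open>i \<ge> 1\<close> in the shift rules.\<close>

definition gen :: "nat \<Rightarrow> nat word set" where
  "gen j = toric_gen k n m (wrap n j)"

lemma gen_closed [simp]: "gen j \<in> carrier W"
  unfolding gen_def by (intro toric_gen_closed wrap_mem pos)

definition \<delta> :: "nat word set" where
  "\<delta> = word_eval W (toric_gen k n m) (cyc_word n m 1)"

lemma \<delta>_closed [simp]: "\<delta> \<in> carrier W"
  unfolding \<delta>_def by (rule W.word_eval_closed[OF toric_gen_funcset cyc_word_in_words[OF pos(2)]])

lemma word_eval_cyc_word:
  assumes "i \<ge> 1"
  shows "word_eval W (toric_gen k n m) (cyc_word n m i) = \<delta>"
proof -
  have *: "word_eval W (toric_gen k n m) (cyc_word n m i) = \<delta>" if "i \<in> {1..n}" for i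
  proof (cases "i = 1")
    case False
    with that have "(cyc_word n m 1, cyc_word n m i) \<in> toric_rels k n m"
      by (auto simp: toric_rels_def)
    from presented_rel[OF this cyc_word_in_words[OF pos(2)] cyc_word_in_words[OF pos(2)]]
    show ?thesis by (simp add: \<delta>_def toric_group_def toric_gen_eq)
  qed (simp add: \<delta>_def)
  \<comment> \<open>The relations only treat starting indices up to \<open>n\<close>; any other
    index is first reduced by \<open>wrap\<close>.\<close>
  show ?thesis
    using *[OF wrap_mem[OF pos(2), of i]] cyc_word_wrap[OF assms] by simp
qed

lemma toric_gen_pow: "i \<in> {1..n} \<Longrightarrow> toric_gen k n m i [^]\<^bsub>W\<^esub> k = \<one>\<^bsub>W\<^esub>"
proof -
  assume i: "i \<in> {1..n}"
  then have "(replicate k (letter i), []) \<in> toric_rels k n m" "replicate k (letter i) \<in> words {1..n}"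
    by (auto simp: toric_rels_def words_def)
  from presented_rel[OF this words_Nil]
  have "word_eval W (toric_gen k n m) (replicate k (letter i)) = \<one>\<^bsub>W\<^esub>"
    by (simp add: toric_group_def toric_gen_eq)
  then show ?thesis
    using W.word_eval_replicate[of "toric_gen k n m" i k] i by simp
qed

text \<open>Neighbouring cyclic words overlap: with the common middle part \<open>P\<close>,
  \<delta> is both x_i P and P x_(i+m), so both sides equal x_i P x_(i+m).\<close>

lemma \<delta>_gen:
  assumes "i \<ge> 1"
  shows "\<delta> \<otimes>\<^bsub>W\<^esub> gen (i + m) = gen i \<otimes>\<^bsub>W\<^esub> \<delta>"
proof -
  define P where "P = map (\<lambda>j. letter (wrap n j)) [i + 1..<i + m]"
  have P: "P \<in> words {1..n}" using wrap_mem[OF pos(2)] by (auto simp: P_def words_def)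
  have l: "[letter (wrap n j)] \<in> words {1..n}" for j using wrap_mem[OF pos(2)] by simp
  have g: "word_eval W (toric_gen k n m) [letter (wrap n j)] = gen j" for j
    using gen_closed[of j] by (simp add: gen_def)
  have Pc: "word_eval W (toric_gen k n m) P \<in> carrier W"
    by (rule W.word_eval_closed[OF toric_gen_funcset P])
  have "cyc_word n m i = [letter (wrap n i)] @ P" "cyc_word n m (i + 1) = P @ [letter (wrap n (i + m))]"
    using pos(3) by (simp_all add: P_def cyc_word_def upt_conv_Cons)
  then have "\<delta> = gen i \<otimes>\<^bsub>W\<^esub> word_eval W (toric_gen k n m) P"
     "\<delta> = word_eval W (toric_gen k n m) P \<otimes>\<^bsub>W\<^esub> gen (i + m)"
    using word_eval_cyc_word[OF assms] word_eval_cyc_word[of "i + 1"]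
      W.word_eval_append[OF toric_gen_funcset P l] W.word_eval_append[OF toric_gen_funcset l P] g
    by simp_all
  then show ?thesis
    using Pc by (metis W.m_assoc gen_closed)
qed

lemma toric_hom_eqI:
  assumes "group G" "h \<in> hom W G" "h' \<in> hom W G"
    and "\<And>i. i \<ge> 1 \<Longrightarrow> h (gen i) = h' (gen i)" and "A \<in> carrier W"
  shows "h A = h' A"
proof (rule group.presented_hom_eqI[OF assms(1)])
  show "h \<in> hom (presented {1..n} (toric_rels k n m)) G" "h' \<in> hom (presented {1..n} (toric_rels k n m)) G"
    "A \<in> carrier (presented {1..n} (toric_rels k n m))"
    using assms by (simp_all add: toric_group_def)
  show "h (pres_gen {1..n} (toric_rels k n m) x) = h' (pres_gen {1..n} (toric_rels k n m) x)"
    if "x \<in> {1..n}" for x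
    using assms(4)[of x] that by (simp add: gen_def wrap_id toric_gen_eq)
qed

text \<open>Shifting the letters turns a cyclic word into the next one, and all of these have the
  value \<delta>, so the relations survive.\<close>

lemma ex_shift: "\<exists>\<sigma> \<in> hom W W. \<forall>i\<ge>1. \<sigma> (gen i) = gen (i + 1)"
proof -
  let ?f = "\<lambda>i. gen (i + 1)"
  have f: "?f \<in> {1..n} \<rightarrow> carrier W" by simp
  have cyc: "word_eval W ?f (cyc_word n m i) = \<delta>" if "i \<ge> 1" for i
    using that word_eval_cyc_word[of "i + 1"]
      word_eval_map_apfst[of W "toric_gen k n m" "\<lambda>j. wrap n (j + 1)" "cyc_word n m i"]
    by (simp only: gen_def cyc_word_shift trans_le_add1)
  have "\<exists>\<sigma> \<in> hom (presented {1..n} (toric_rels k n m)) W.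
      \<forall>i\<in>{1..n}. \<sigma> (pres_gen {1..n} (toric_rels k n m) i) = ?f i"
  proof (rule W.presented_lift[OF f])
    fix u v assume "(u, v) \<in> toric_rels k n m"
    then show "word_eval W ?f u = word_eval W ?f v"
      unfolding toric_rels_def
    proof (elim UnE CollectE exE conjE)
      fix i assume "(u, v) = (replicate k (letter i), [])"
      then show ?thesis
        using toric_gen_pow[OF wrap_mem[OF pos(2)]] by (simp add: W.word_eval_replicate) (simp add: gen_def)
    next
      fix i assume "(u, v) = (cyc_word n m 1, cyc_word n m i)" "i \<in> {2..n}"
      then show ?thesis using cyc[of 1] cyc[of i] by simp
    qed
  qed
  then obtain \<sigma> where s: "\<sigma> \<in> hom W W" "\<And>i. i \<in> {1..n} \<Longrightarrow> \<sigma> (toric_gen k n m i) = ?f i"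
    by (auto simp: toric_group_def toric_gen_eq)
  have "\<sigma> (gen i) = gen (i + 1)" if "i \<ge> 1" for i
    using s(2)[OF wrap_mem[OF pos(2), of i]] wrap_wrap_add[OF that, of n 1] by (simp add: gen_def)
  with s(1) show ?thesis by blast
qed

text \<open>On \<open>carrier W\<close> a homomorphism is determined by the generators, so the
  choice can only vary outside it.\<close>

definition \<sigma> :: "nat word set \<Rightarrow> nat word set" where
  "\<sigma> = (SOME \<sigma>. \<sigma> \<in> hom W W \<and> (\<forall>i\<ge>1. \<sigma> (gen i) = gen (i + 1)))"

lemma \<sigma>_hom: "\<sigma> \<in> hom W W" and \<sigma>_gen: "i \<ge> 1 \<Longrightarrow> \<sigma> (gen i) = gen (i + 1)"
  using someI_ex[OF ex_shift[unfolded Bex_def]] unfolding \<sigma>_def by auto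

sublocale \<sigma>: group_hom W W \<sigma>
  by unfold_locales (rule \<sigma>_hom)

lemma \<sigma>_\<delta>: "\<sigma> \<delta> = \<delta>"
proof -
  have "\<sigma> \<delta> = word_eval W (\<lambda>i. \<sigma> (toric_gen k n m i)) (cyc_word n m 1)"
    unfolding \<delta>_def by (rule \<sigma>.hom_word_eval[OF toric_gen_funcset cyc_word_in_words[OF pos(2)]])
  also have "\<dots> = word_eval W (\<lambda>i. toric_gen k n m (wrap n (i + 1))) (cyc_word n m 1)"
  proof (rule word_eval_cong[OF cyc_word_in_words[OF pos(2)]])
    show "\<sigma> (toric_gen k n m i) = toric_gen k n m (wrap n (i + 1))" if "i \<in> {1..n}" for i
      using \<sigma>_gen[of i] that by (simp add: gen_def wrap_id)
  qed
  also have "\<dots> = \<delta>"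
    using word_eval_cyc_word[of "1 + 1"]
      word_eval_map_apfst[of W "toric_gen k n m" "\<lambda>j. wrap n (j + 1)" "cyc_word n m 1"]
    by (simp only: cyc_word_shift order_refl trans_le_add1)
  finally show ?thesis .
qed

lemma \<sigma>_pow_hom: "\<sigma> ^^ i \<in> hom W W"
  by (induction i) (auto simp: hom_def \<sigma>.hom_closed Pi_iff)

lemma \<sigma>_pow_gen: "j \<ge> 1 \<Longrightarrow> (\<sigma> ^^ i) (gen j) = gen (j + i)"
  by (induction i) (auto simp: \<sigma>_gen)

lemma \<sigma>_pow_closed: "v \<in> carrier W \<Longrightarrow> (\<sigma> ^^ i) v \<in> carrier W"
  using \<sigma>_pow_hom by (auto simp: hom_def)

lemma \<sigma>_pow_n:
  assumes "v \<in> carrier W"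
  shows "(\<sigma> ^^ n) v = v"
proof -
  have "id \<in> hom W W" by (auto simp: hom_def)
  moreover have "(\<sigma> ^^ n) (gen i) = id (gen i)" if "i \<ge> 1" for i
    using that by (cases i) (simp_all add: \<sigma>_pow_gen, simp add: gen_def wrap_def)
  ultimately show ?thesis
    using toric_hom_eqI[OF W.is_group \<sigma>_pow_hom, of id n v] assms by simp
qed

text \<open>The m-th power of the shift is inner: by \<open>\<delta>_gen\<close> it agrees on the
  generators with conjugation by the inverse of \<delta>, hence everywhere.\<close>

lemma \<delta>_\<sigma>_pow_m:
  assumes v: "v \<in> carrier W"
  shows "\<delta> \<otimes>\<^bsub>W\<^esub> (\<sigma> ^^ m) v = v \<otimes>\<^bsub>W\<^esub> \<delta>"
proof -
  have "(\<sigma> ^^ m) v = conj_by W (inv\<^bsub>W\<^esub> \<delta>) v"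
  proof (rule toric_hom_eqI[OF W.is_group \<sigma>_pow_hom W.conj_by_hom _ v])
    show "(\<sigma> ^^ m) (gen i) = conj_by W (inv\<^bsub>W\<^esub> \<delta>) (gen i)" if "i \<ge> 1" for i
      using \<delta>_gen[OF that] that
      by (simp add: conj_by_def \<sigma>_pow_gen W.m_assoc W.inv_solve_left)
  qed simp
  then show ?thesis
    using v by (simp add: conj_by_def W.m_assoc W.inv_cancel_left)
qed

section \<open>Left multiplications and the shift acting on m copies of W\<close>

definition Y :: "(nat word set \<times> nat) set" where
  "Y = carrier W \<times> {..<m}"

text \<open>The lambda restricted to \<open>Y\<close> makes the map \<open>undefined\<close>
  elsewhere, as membership in \<open>Bij Y\<close> includes extensionality.\<close>

definition L :: "nat word set \<Rightarrow> nat word set \<times> nat \<Rightarrow> nat word set \<times> nat" where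
  "L w = (\<lambda>(v, j)\<in>Y. (w \<otimes>\<^bsub>W\<^esub> v, j))"

definition \<tau> :: "nat word set \<times> nat \<Rightarrow> nat word set \<times> nat" where
  "\<tau> = (\<lambda>(v, j)\<in>Y. (\<sigma> v, j))"

text \<open>An \<open>m\<close>-th root of right multiplication by \<open>\<delta>\<close> on \<open>m\<close> copies of \<open>W\<close>.\<close>

definition \<zeta> :: "nat word set \<times> nat \<Rightarrow> nat word set \<times> nat" where
  "\<zeta> = (\<lambda>(v, j)\<in>Y. if j + 1 < m then (v, j + 1) else (v \<otimes>\<^bsub>W\<^esub> \<delta>, 0))"

sublocale B: group "BijGroup Y"
  by (rule group_BijGroup)

lemma L_Bij [simp]: "w \<in> carrier W \<Longrightarrow> L w \<in> Bij Y"
  unfolding L_def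
  by (intro restrict_Bij bij_betw_byWitness[where f' = "\<lambda>(v, j). (inv\<^bsub>W\<^esub> w \<otimes>\<^bsub>W\<^esub> v, j)"])
    (auto simp: Y_def W.m_assoc[symmetric])

lemma \<tau>_pow_apply:
  "v \<in> carrier W \<Longrightarrow> j < m \<Longrightarrow> (\<tau> ^^ i) (v, j) = ((\<sigma> ^^ i) v, j)"
  by (induction i) (auto simp: \<tau>_def Y_def \<sigma>_pow_closed)

lemma \<tau>_Bij [simp]: "\<tau> \<in> Bij Y"
  unfolding \<tau>_def
\<comment> \<open>As the n-th power of \<sigma> is the identity on \<open>carrier W\<close>, its
  (n-1)-st power is the inverse.\<close>
proof (intro restrict_Bij bij_betw_byWitness[where f' = "\<lambda>(v, j). ((\<sigma> ^^ (n - 1)) v, j)"])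
  have "(\<sigma> ^^ (n - 1)) (\<sigma> v) = v" "\<sigma> ((\<sigma> ^^ (n - 1)) v) = v" if "v \<in> carrier W" for v
    using \<sigma>_pow_n[OF that] pos(2) by (cases n; simp add: funpow_swap1)+
  then show "\<forall>a\<in>Y. (case case a of (v, j) \<Rightarrow> (\<sigma> v, j) of (v, j) \<Rightarrow> ((\<sigma> ^^ (n - 1)) v, j)) = a"
    "\<forall>a'\<in>Y. (case case a' of (v, j) \<Rightarrow> ((\<sigma> ^^ (n - 1)) v, j) of (v, j) \<Rightarrow> (\<sigma> v, j)) = a'"
    by (auto simp: Y_def)
qed (auto simp: Y_def \<sigma>_pow_closed)

lemma \<zeta>_Bij [simp]: "\<zeta> \<in> Bij Y"
  unfolding \<zeta>_def
  by (intro restrict_Bij bij_betw_byWitness[where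
        f' = "\<lambda>(v, j). if j = 0 then (v \<otimes>\<^bsub>W\<^esub> inv\<^bsub>W\<^esub> \<delta>, m - 1) else (v, j - 1)"])
    (use pos(3) in \<open>auto simp: Y_def W.m_assoc split: if_splits\<close>)

text \<open>At most \<open>m\<close> steps pass the end of the cycle of copies at most once, so at
  most one factor \<delta> appears. At \<open>i = m\<close> exactly one does, and \<open>j\<close>
  is restored.\<close>

lemma \<zeta>_pow_apply:
  assumes "v \<in> carrier W" "j < m"
  shows "i \<le> m \<Longrightarrow> (\<zeta> ^^ i) (v, j) = (if j + i < m then (v, j + i) else (v \<otimes>\<^bsub>W\<^esub> \<delta>, j + i - m))"
  by (induction i) (use assms in \<open>auto simp: \<zeta>_def Y_def\<close>)

lemma L_hom: "L \<in> hom W (BijGroup Y)"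
proof (rule homI)
  fix w w' assume w: "w \<in> carrier W" "w' \<in> carrier W"
  show "L (w \<otimes>\<^bsub>W\<^esub> w') = L w \<otimes>\<^bsub>BijGroup Y\<^esub> L w'"
  proof (rule BijGroup_eqI[of _ Y])
    show "L w \<otimes>\<^bsub>BijGroup Y\<^esub> L w' \<in> Bij Y"
      using w B.m_closed by (simp add: carrier_BijGroup)
  next
    fix x assume "x \<in> Y"
    then show "L (w \<otimes>\<^bsub>W\<^esub> w') x = (L w \<otimes>\<^bsub>BijGroup Y\<^esub> L w') x"
      using w by (simp add: BijGroup_mult_apply) (auto simp: L_def Y_def W.m_assoc)
  qed (use w in simp)
qed (simp add: carrier_BijGroup)

sublocale L: group_hom W "BijGroup Y" L
  by unfold_locales (rule L_hom)

lemma Bij_mult [simp]: "f \<in> Bij Y \<Longrightarrow> g \<in> Bij Y \<Longrightarrow> f \<otimes>\<^bsub>BijGroup Y\<^esub> g \<in> Bij Y"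
  using B.m_closed by (simp add: carrier_BijGroup)

lemma Bij_pow [simp]: "f \<in> Bij Y \<Longrightarrow> f [^]\<^bsub>BijGroup Y\<^esub> (i::nat) \<in> Bij Y"
  using B.nat_pow_closed by (simp add: carrier_BijGroup)

lemma Bij_inv [simp]: "f \<in> Bij Y \<Longrightarrow> inv\<^bsub>BijGroup Y\<^esub> f \<in> Bij Y"
  using B.inv_closed by (simp add: carrier_BijGroup)

text \<open>This is the multiplicativity \<sigma>(w v) = \<sigma>(w) \<sigma>(v): \<tau> and the
  left multiplications compose as in a semidirect product.\<close>

lemma conj_by_\<tau>:
  assumes w: "w \<in> carrier W"
  shows "conj_by (BijGroup Y) \<tau> (L w) = L (\<sigma> w)"
proof -
  have "\<tau> \<otimes>\<^bsub>BijGroup Y\<^esub> L w = L (\<sigma> w) \<otimes>\<^bsub>BijGroup Y\<^esub> \<tau>"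
    by (rule BijGroup_eqI[of _ Y])
      (use w in \<open>auto simp: BijGroup_mult_apply\<close>, auto simp: L_def \<tau>_def Y_def)
  then show ?thesis
    using w by (simp add: conj_by_def B.m_assoc carrier_BijGroup)
qed

lemma conj_by_\<tau>_pow:
  "w \<in> carrier W \<Longrightarrow> conj_by (BijGroup Y) (\<tau> [^]\<^bsub>BijGroup Y\<^esub> i) (L w) = L ((\<sigma> ^^ i) w)"
proof (induction i arbitrary: w)
  case (Suc i)
  have "conj_by (BijGroup Y) (\<tau> [^]\<^bsub>BijGroup Y\<^esub> Suc i) (L w)
      = conj_by (BijGroup Y) (\<tau> [^]\<^bsub>BijGroup Y\<^esub> i) (conj_by (BijGroup Y) \<tau> (L w))"
    using Suc.prems by (simp add: B.conj_by_conj_by carrier_BijGroup)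
  also have "\<dots> = L ((\<sigma> ^^ i) (\<sigma> w))"
    using Suc by (simp add: conj_by_\<tau>)
  finally show ?case by (simp add: funpow_swap1)
qed (simp add: carrier_BijGroup)

lemma L_gen: "i \<ge> 1 \<Longrightarrow> L (gen i) = conj_by (BijGroup Y) (\<tau> [^]\<^bsub>BijGroup Y\<^esub> (i - 1)) (L (gen 1))"
  by (simp add: conj_by_\<tau>_pow \<sigma>_pow_gen)

lemma \<tau>_pow_n: "\<tau> [^]\<^bsub>BijGroup Y\<^esub> n = \<one>\<^bsub>BijGroup Y\<^esub>"
proof (rule BijGroup_eqI[of _ Y])
  show "\<one>\<^bsub>BijGroup Y\<^esub> \<in> Bij Y" using B.one_closed by (simp only: carrier_BijGroup)
next
  fix x assume "x \<in> Y"
  then show "(\<tau> [^]\<^bsub>BijGroup Y\<^esub> n) x = \<one>\<^bsub>BijGroup Y\<^esub> x"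
    by (simp add: BijGroup_pow_apply one_BijGroup_apply) (auto simp: Y_def \<tau>_pow_apply \<sigma>_pow_n)
qed simp

text \<open>Computing \<open>L \<delta>\<close> by the telescoping formula gives (x_1 \<tau>)^m =
  L(\<delta>) \<tau>^m. On each copy this sends v to \<delta> \<sigma>^m(v) = v \<delta>, as
  \<zeta>^m does.\<close>

lemma L_gen_\<tau>_pow: "(L (gen 1) \<otimes>\<^bsub>BijGroup Y\<^esub> \<tau>) [^]\<^bsub>BijGroup Y\<^esub> m = \<zeta> [^]\<^bsub>BijGroup Y\<^esub> m"
proof -
  let ?c = "\<lambda>i. conj_by (BijGroup Y) (\<tau> [^]\<^bsub>BijGroup Y\<^esub> (i - 1)) (L (gen 1))"
  let ?p = "(L (gen 1) \<otimes>\<^bsub>BijGroup Y\<^esub> \<tau>) [^]\<^bsub>BijGroup Y\<^esub> m"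
  have "L \<delta> = word_eval (BijGroup Y) (\<lambda>i. L (toric_gen k n m i)) (cyc_word n m 1)"
    unfolding \<delta>_def by (rule L.hom_word_eval[OF toric_gen_funcset cyc_word_in_words[OF pos(2)]])
  also have "\<dots> = word_eval (BijGroup Y) ?c (cyc_word n m 1)"
  proof (rule word_eval_cong[OF cyc_word_in_words[OF pos(2)]])
    show "L (toric_gen k n m i) = ?c i" if "i \<in> {1..n}" for i
      using L_gen[of i] that by (simp add: gen_def wrap_id)
  qed
  also have "\<dots> = ?p \<otimes>\<^bsub>BijGroup Y\<^esub> inv\<^bsub>BijGroup Y\<^esub> (\<tau> [^]\<^bsub>BijGroup Y\<^esub> m)"
    using B.word_eval_cyc_word_conj[OF _ _ \<tau>_pow_n, of "L (gen 1)" 1 m] by (simp add: carrier_BijGroup)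
  finally have "?p = L \<delta> \<otimes>\<^bsub>BijGroup Y\<^esub> \<tau> [^]\<^bsub>BijGroup Y\<^esub> m"
    by (simp add: B.m_assoc carrier_BijGroup)
  also have "\<dots> = \<zeta> [^]\<^bsub>BijGroup Y\<^esub> m"
  proof (rule BijGroup_eqI[of _ Y])
    fix x assume "x \<in> Y"
    then show "(L \<delta> \<otimes>\<^bsub>BijGroup Y\<^esub> \<tau> [^]\<^bsub>BijGroup Y\<^esub> m) x = (\<zeta> [^]\<^bsub>BijGroup Y\<^esub> m) x"
      by (simp add: BijGroup_mult_apply BijGroup_pow_apply)
        (auto simp: Y_def \<tau>_pow_apply \<zeta>_pow_apply L_def \<delta>_\<sigma>_pow_m \<sigma>_pow_closed)
  qed simp_all
  finally show ?thesis .
qed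

text \<open>The role of the central element is played by \<zeta>, which commutes with left
  multiplications because it only multiplies on the right and moves between copies.\<close>

lemma ex_action:
  "\<exists>g \<in> hom J (BijGroup Y). g (J_gen k n m S) = L (gen 1) \<and> g (J_gen k n m T) = \<tau>"
proof (rule B.J_parent_lift)
  show "L (gen 1) [^]\<^bsub>BijGroup Y\<^esub> k = \<one>\<^bsub>BijGroup Y\<^esub>"
    using L.hom_nat_pow[OF gen_closed, of 1 k] toric_gen_pow[OF wrap_mem[OF pos(2)], of 1] L.hom_one
    by (simp flip: gen_def)
  show "\<zeta> \<otimes>\<^bsub>BijGroup Y\<^esub> L (gen 1) = L (gen 1) \<otimes>\<^bsub>BijGroup Y\<^esub> \<zeta>"
    by (rule BijGroup_eqI[of _ Y])
      (auto simp: BijGroup_mult_apply, auto simp: L_def \<zeta>_def Y_def W.m_assoc)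
  \<comment> \<open>Here \<sigma> has to fix \<delta>, the factor that \<zeta> introduces.\<close>
  show "\<zeta> \<otimes>\<^bsub>BijGroup Y\<^esub> \<tau> = \<tau> \<otimes>\<^bsub>BijGroup Y\<^esub> \<zeta>"
    by (rule BijGroup_eqI[of _ Y])
      (auto simp: BijGroup_mult_apply, auto simp: \<tau>_def \<zeta>_def Y_def \<sigma>_\<delta>)
qed (use \<tau>_pow_n L_gen_\<tau>_pow in \<open>simp_all add: carrier_BijGroup\<close>)

section \<open>The homomorphism from W to the parent J-group\<close>

abbreviation s where "s \<equiv> J_gen k n m S"
abbreviation t where "t \<equiv> J_gen k n m T"
abbreviation u where "u \<equiv> J_gen k n m U"

definition z :: "stu word set" where
  "z = s \<otimes>\<^bsub>J\<^esub> t \<otimes>\<^bsub>J\<^esub> u"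

lemma J_gen_closed [simp]: "J_gen k n m x \<in> carrier J"
  unfolding J_gen_def J_parent_def by (rule pres_gen_closed) simp

lemma z_closed [simp]: "z \<in> carrier J"
  by (simp add: z_def)

lemma J_rel:
  assumes "(v, w) \<in> J_rels k n m"
  shows "word_eval J (J_gen k n m) v = word_eval J (J_gen k n m) w"
  using presented_rel[OF assms, of UNIV]
  by (simp add: J_gen_def[abs_def] J_parent_def words_def)

lemma J_gen_pow: "s [^]\<^bsub>J\<^esub> k = \<one>\<^bsub>J\<^esub>" "t [^]\<^bsub>J\<^esub> n = \<one>\<^bsub>J\<^esub>" "u [^]\<^bsub>J\<^esub> m = \<one>\<^bsub>J\<^esub>"
  using J_rel[of "replicate k (letter S)" "[]"] J_rel[of "replicate n (letter T)" "[]"]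
    J_rel[of "replicate m (letter U)" "[]"]
  by (simp_all add: J_rels_def J.word_eval_replicate)

lemma z_eqs: "t \<otimes>\<^bsub>J\<^esub> u \<otimes>\<^bsub>J\<^esub> s = z" "u \<otimes>\<^bsub>J\<^esub> s \<otimes>\<^bsub>J\<^esub> t = z"
  using J_rel[of "[letter S, letter T, letter U]" "[letter T, letter U, letter S]"]
    J_rel[of "[letter T, letter U, letter S]" "[letter U, letter S, letter T]"]
  by (simp_all add: J_rels_def z_def J.m_assoc)

text \<open>Moving a generator past \<open>z\<close> rotates the product, as in (s t u) s = s (t u
  s), and all rotations are equal.\<close>

lemma z_commute_gen: "z \<otimes>\<^bsub>J\<^esub> J_gen k n m x = J_gen k n m x \<otimes>\<^bsub>J\<^esub> z"
proof (cases x)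
  case S
  have "z \<otimes>\<^bsub>J\<^esub> s = s \<otimes>\<^bsub>J\<^esub> (t \<otimes>\<^bsub>J\<^esub> u \<otimes>\<^bsub>J\<^esub> s)" by (simp add: z_def J.m_assoc)
  then show ?thesis using S z_eqs by simp
next
  case T
  have "t \<otimes>\<^bsub>J\<^esub> u \<otimes>\<^bsub>J\<^esub> s \<otimes>\<^bsub>J\<^esub> t = t \<otimes>\<^bsub>J\<^esub> (u \<otimes>\<^bsub>J\<^esub> s \<otimes>\<^bsub>J\<^esub> t)" by (simp add: J.m_assoc)
  then show ?thesis using T z_eqs by simp
next
  case U
  have "u \<otimes>\<^bsub>J\<^esub> s \<otimes>\<^bsub>J\<^esub> t \<otimes>\<^bsub>J\<^esub> u = u \<otimes>\<^bsub>J\<^esub> z" by (simp add: z_def J.m_assoc)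
  then show ?thesis using U z_eqs by simp
qed

text \<open>\<open>u\<close> commutes with s t since both products are \<open>z\<close>; so z^m = (s
  t)^m u^m, and u^m is trivial.\<close>

lemma st_pow: "(s \<otimes>\<^bsub>J\<^esub> t) [^]\<^bsub>J\<^esub> m = z [^]\<^bsub>J\<^esub> m"
proof -
  have "z [^]\<^bsub>J\<^esub> m = (s \<otimes>\<^bsub>J\<^esub> t) [^]\<^bsub>J\<^esub> m \<otimes>\<^bsub>J\<^esub> u [^]\<^bsub>J\<^esub> m"
    unfolding z_def
    by (rule J.pow_mult_distrib) (use z_eqs(2) in \<open>simp_all add: z_def J.m_assoc\<close>)
  then show ?thesis by (simp add: J_gen_pow)
qed

lemma ex_toric_to_J:
  "\<exists>h \<in> hom W J. \<forall>i\<ge>1. h (gen i) = conj_by J (t [^]\<^bsub>J\<^esub> (i - 1)) s"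
proof -
  let ?f = "\<lambda>i. conj_by J (t [^]\<^bsub>J\<^esub> (i - 1)) s"
  \<comment> \<open>(s t)^m is a power of \<open>z\<close>, so it commutes with \<open>t\<close>;
    under this condition the conjugates of \<open>s\<close> obey the toric relations.\<close>
  have c: "(s \<otimes>\<^bsub>J\<^esub> t) [^]\<^bsub>J\<^esub> m \<otimes>\<^bsub>J\<^esub> t = t \<otimes>\<^bsub>J\<^esub> (s \<otimes>\<^bsub>J\<^esub> t) [^]\<^bsub>J\<^esub> m"
    unfolding st_pow by (rule J.group_commutes_pow[OF z_commute_gen]) simp_all
  have "\<exists>h \<in> hom (presented {1..n} (toric_rels k n m)) J.
      \<forall>i\<in>{1..n}. h (pres_gen {1..n} (toric_rels k n m) i) = ?f i"
    by (rule J.presented_lift) (use J.toric_rels_conj[OF _ _ J_gen_pow(1,2) c] in auto)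
  then obtain h where h: "h \<in> hom W J" "\<And>i. i \<in> {1..n} \<Longrightarrow> h (toric_gen k n m i) = ?f i"
    by (auto simp: toric_group_def toric_gen_eq)
  \<comment> \<open>Since t^n is trivial, the reduction of the index inside \<open>gen\<close> does
    not change the conjugate.\<close>
  have "h (gen i) = ?f i" for i
    using h(2)[OF wrap_mem[OF pos(2), of i]] J.pow_mod_eq[OF J_gen_closed J_gen_pow(2), of "i - 1"]
    by (simp add: gen_def wrap_def)
  with h(1) show ?thesis by blast
qed

definition \<eta> :: "nat word set \<Rightarrow> stu word set" where
  "\<eta> = (SOME h. h \<in> hom W J \<and> (\<forall>i\<ge>1. h (gen i) = conj_by J (t [^]\<^bsub>J\<^esub> (i - 1)) s))"

lemma \<eta>_hom: "\<eta> \<in> hom W J"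
  and \<eta>_gen: "i \<ge> 1 \<Longrightarrow> \<eta> (gen i) = conj_by J (t [^]\<^bsub>J\<^esub> (i - 1)) s"
  using someI_ex[OF ex_toric_to_J[unfolded Bex_def]] unfolding \<eta>_def by auto

sublocale \<eta>: group_hom W J \<eta>
  by unfold_locales (rule \<eta>_hom)

text \<open>Composing with the action turns \<eta> into left multiplication, from which the element
  can be read off.\<close>

lemma inj_\<eta>: "inj_on \<eta> (carrier W)"
proof -
  obtain g where g: "g \<in> hom J (BijGroup Y)" "g s = L (gen 1)" "g t = \<tau>"
    using ex_action by blast
  interpret g: group_hom J "BijGroup Y" g
    by unfold_locales (rule g(1))
  have gL: "(g \<circ> \<eta>) A = L A" if "A \<in> carrier W" for A
  proof (rule toric_hom_eqI[OF B.is_group _ L_hom _ that])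
    show "g \<circ> \<eta> \<in> hom W (BijGroup Y)" using \<eta>_hom g(1) by (rule hom_compose)
    show "(g \<circ> \<eta>) (gen i) = L (gen i)" if "i \<ge> 1" for i
      using that g by (simp add: \<eta>_gen L_gen[OF that] conj_by_def g.hom_nat_pow)
  qed
  show ?thesis
  proof (rule inj_onI)
    fix A A' assume A: "A \<in> carrier W" "A' \<in> carrier W" "\<eta> A = \<eta> A'"
    \<comment> \<open>Evaluation at the identity in copy 0, which exists as
      \<open>m > 0\<close>.\<close>
    have "L A (\<one>\<^bsub>W\<^esub>, 0) = L A' (\<one>\<^bsub>W\<^esub>, 0)"
      using gL[OF A(1)] gL[OF A(2)] A(3) by simp
    then show "A = A'" using A pos(3) by (simp add: L_def Y_def)
  qed
qed

text \<open>Conjugation by \<open>t\<close> raises the exponent of \<open>t\<close> in the image of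
  each generator by one, just as the shift does. It follows that \<open>t\<close> normalises the
  image of \<eta>.\<close>

lemma conj_\<eta>:
  assumes "A \<in> carrier W"
  shows "conj_by J t (\<eta> A) = \<eta> (\<sigma> A)"
proof -
  have "(conj_by J t \<circ> \<eta>) A = (\<eta> \<circ> \<sigma>) A"
  proof (rule toric_hom_eqI[OF J.is_group _ _ _ assms])
    show "conj_by J t \<circ> \<eta> \<in> hom W J" by (intro hom_compose[OF \<eta>_hom] J.conj_by_hom) simp
    show "\<eta> \<circ> \<sigma> \<in> hom W J" by (rule hom_compose[OF \<sigma>_hom \<eta>_hom])
    show "(conj_by J t \<circ> \<eta>) (gen i) = (\<eta> \<circ> \<sigma>) (gen i)" if i: "i \<ge> 1" for i
    proof -
      obtain j where "i = Suc j" using i by (cases i) auto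
      then show ?thesis
        using J.nat_pow_Suc2[of t j] by (simp add: \<eta>_gen \<sigma>_gen J.conj_by_conj_by)
    qed
  qed
  then show ?thesis by simp
qed

section \<open>The image as a normal closure\<close>

lemma J_induct [consumes 1, case_names one gen inv mult]:
  assumes "g \<in> carrier J"
    and "P \<one>\<^bsub>J\<^esub>" "\<And>x. P (J_gen k n m x)" "\<And>x. P (inv\<^bsub>J\<^esub> (J_gen k n m x))"
    and "\<And>g g'. g \<in> carrier J \<Longrightarrow> g' \<in> carrier J \<Longrightarrow> P g \<Longrightarrow> P g' \<Longrightarrow> P (g \<otimes>\<^bsub>J\<^esub> g')"
  shows "P g"
proof -
  have J: "J_gen k n m \<in> UNIV \<rightarrow> carrier J" by simp
  obtain w where w: "w \<in> words UNIV" "g = word_eval J (J_gen k n m) w"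
    using assms(1) word_eval_pres_gen
    unfolding J_parent_def J_gen_def[abs_def] by (metis presented_carrierE)
  have "P (word_eval J (J_gen k n m) w)"
    using w(1)
  proof (induction w)
    case (Cons y w)
    obtain x e where y: "y = (x, e)" by (cases y)
    show ?case
      using Cons assms(3-5) y J.word_eval_closed[OF J, of w] by (cases e) auto
  qed (use assms(2) in simp)
  then show ?thesis by (simp add: w(2))
qed

text \<open>Only conjugation into the image is required, so closure under products is immediate but
  closure under inverses is not; the finite order of the generators supplies what is needed.\<close>

definition normaliser :: "stu word set set" where
  "normaliser = {g \<in> carrier J. \<forall>h \<in> \<eta> ` carrier W. conj_by J g h \<in> \<eta> ` carrier W}"

lemma subgroup_\<eta>: "subgroup (\<eta> ` carrier W) J"
  by (rule \<eta>.img_is_subgroup)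

lemma s_mem: "s \<in> \<eta> ` carrier W"
proof -
  have "\<eta> (gen 1) = s" using \<eta>_gen[of 1] by simp
  then show ?thesis by (metis gen_closed imageI)
qed

lemma z_commute: "g \<in> carrier J \<Longrightarrow> z \<otimes>\<^bsub>J\<^esub> g = g \<otimes>\<^bsub>J\<^esub> z"
proof (induction rule: J_induct)
  case (inv x)
  show ?case by (rule J.commute_inv) (simp_all add: z_commute_gen)
next
  case (mult g g')
  then show ?case by (metis J.m_assoc z_closed)
qed (simp_all add: z_commute_gen)

lemma normaliser_mult:
  "g \<in> normaliser \<Longrightarrow> g' \<in> normaliser \<Longrightarrow> g \<otimes>\<^bsub>J\<^esub> g' \<in> normaliser"
  by (auto simp: normaliser_def simp flip: J.conj_by_conj_by)

lemma normaliser_one: "\<one>\<^bsub>J\<^esub> \<in> normaliser"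
  by (simp add: normaliser_def)

lemma normaliser_pow: "g \<in> normaliser \<Longrightarrow> g [^]\<^bsub>J\<^esub> (i::nat) \<in> normaliser"
  by (induction i) (auto intro: normaliser_mult normaliser_one)

lemma normaliser_inv:
  assumes "g \<in> normaliser" "g [^]\<^bsub>J\<^esub> (i::nat) = \<one>\<^bsub>J\<^esub>" "i > 0"
  shows "inv\<^bsub>J\<^esub> g \<in> normaliser"
proof -
  have g: "g \<in> carrier J" using assms(1) by (simp add: normaliser_def)
  have "g [^]\<^bsub>J\<^esub> (i - 1) \<otimes>\<^bsub>J\<^esub> g = \<one>\<^bsub>J\<^esub>"
    using assms(2,3) by (cases i) simp_all
  then have "inv\<^bsub>J\<^esub> g = g [^]\<^bsub>J\<^esub> (i - 1)"
    by (rule J.inv_equality) (use g in simp_all)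
  then show ?thesis using normaliser_pow[OF assms(1)] by simp
qed

text \<open>The subgroup generated by the conjugates of \<open>s\<close> under powers of \<open>t\<close> is normalised by
  \<open>u\<close> as well, because \<open>u\<close> agrees with the inverse of \<open>s t\<close> up to the central element \<open>z\<close>.\<close>

lemma carrier_normaliser:
  assumes "g \<in> carrier J"
  shows "g \<in> normaliser"
proof -
  have s: "s \<in> normaliser"
    using s_mem subgroup_\<eta> by (auto simp: normaliser_def conj_by_def intro!: subgroup.m_closed subgroup.m_inv_closed)
  have t: "t \<in> normaliser"
    by (auto simp: normaliser_def conj_\<eta>)
  have z: "z \<in> normaliser"
    using z_commute by (auto simp: normaliser_def J.conj_by_commute)
  have "inv\<^bsub>J\<^esub> (s \<otimes>\<^bsub>J\<^esub> t) \<otimes>\<^bsub>J\<^esub> z = u"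
    by (simp add: z_def J.inv_solve_left' J.m_assoc)
  moreover have "inv\<^bsub>J\<^esub> (s \<otimes>\<^bsub>J\<^esub> t) = inv\<^bsub>J\<^esub> t \<otimes>\<^bsub>J\<^esub> inv\<^bsub>J\<^esub> s"
    by (simp add: J.inv_mult_group)
  ultimately have u: "u \<in> normaliser"
    using normaliser_inv[OF s J_gen_pow(1) pos(1)] normaliser_inv[OF t J_gen_pow(2) pos(2)] z
    by (metis normaliser_mult)
  show ?thesis
    using assms
  proof (induction rule: J_induct)
    case (gen x)
    then show ?case using s t u by (cases x) auto
  next
    case (inv x)
    then show ?case
      using s t u J_gen_pow pos normaliser_inv by (cases x) auto
  qed (auto intro: normaliser_one normaliser_mult)
qed

lemma image_\<eta>: "\<eta> ` carrier W = carrier (J_group k n m 1 n m)"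
proof -
  let ?R = "{s [^]\<^bsub>J\<^esub> (1::nat), t [^]\<^bsub>J\<^esub> n, u [^]\<^bsub>J\<^esub> m}"
  \<comment> \<open>t^n and u^m are trivial, so only \<open>s\<close> matters for the normal
    closure.\<close>
  have R: "?R = {s, \<one>\<^bsub>J\<^esub>}" by (simp add: J_gen_pow)
  have "\<eta> ` carrier W \<lhd> J"
    unfolding J.normal_inv_iff
  proof (intro conjI ballI subgroup_\<eta>)
    show "g \<otimes>\<^bsub>J\<^esub> h \<otimes>\<^bsub>J\<^esub> inv\<^bsub>J\<^esub> g \<in> \<eta> ` carrier W"
      if "g \<in> carrier J" "h \<in> \<eta> ` carrier W" for g h
      using carrier_normaliser[OF that(1)] that(2) unfolding normaliser_def conj_by_def by blast
  qed
  moreover have "?R \<subseteq> \<eta> ` carrier W"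
    unfolding R using s_mem subgroup.one_closed[OF subgroup_\<eta>] by simp
  ultimately have "normal_closure J ?R \<subseteq> \<eta> ` carrier W"
    unfolding normal_closure_def by blast
  \<comment> \<open>A normal subgroup containing \<open>s\<close> contains its conjugates by powers
    of \<open>t\<close>, hence the image of every word.\<close>
  moreover have "\<eta> ` carrier W \<subseteq> N" if N: "N \<lhd> J" "?R \<subseteq> N" for N
  proof -
    interpret N: normal N J by (rule N(1))
    have gN: "toric_gen k n m \<in> {1..n} \<rightarrow> carrier W" by (rule toric_gen_funcset)
    have mem: "\<eta> (toric_gen k n m i) \<in> N" if "i \<in> {1..n}" for i
      using \<eta>_gen[of i] that N(2) N.inv_op_closed2[of "t [^]\<^bsub>J\<^esub> (i - 1)" s]
      by (simp add: gen_def wrap_id conj_by_def)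
    show ?thesis
    proof
      fix y assume "y \<in> \<eta> ` carrier W"
      then obtain A where A: "A \<in> carrier (presented {1..n} (toric_rels k n m))" "y = \<eta> A"
        by (auto simp: toric_group_def)
      from A(1) obtain w where w: "w \<in> words {1..n}" "A = word_eval W (toric_gen k n m) w"
        by (rule presented_carrierE) (simp add: word_eval_pres_gen toric_group_def toric_gen_eq)
      have "word_eval J (\<lambda>i. \<eta> (toric_gen k n m i)) w \<in> N"
        using w(1) by (induction w) (auto simp: mem)
      then show "y \<in> N"
        using A(2) w(2) \<eta>.hom_word_eval[OF gN w(1)] by simp
    qed
  qed
  then have "\<eta> ` carrier W \<subseteq> normal_closure J ?R"
    unfolding normal_closure_def by blast
  ultimately show ?thesis
    by (simp add: J_group_def)
qed

lemma \<eta>_iso: "\<eta> \<in> iso W (J_group k n m 1 n m)"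
proof -
  have "\<eta> \<in> hom W (J_group k n m 1 n m)"
  proof (rule homI)
    show "\<eta> A \<in> carrier (J_group k n m 1 n m)" if "A \<in> carrier W" for A
      unfolding image_\<eta>[symmetric] using that by (rule imageI)
  qed (simp add: J_group_def)
  then show ?thesis
    using inj_\<eta> image_\<eta> by (simp add: iso_def bij_betw_def)
qed

end

section \<open>Reflections in the representation\<close>

lemma AA_root_square_neq_1:
  assumes "a \<ge> 2"
  shows "(AA_root a)\<^sup>2 \<noteq> 1"
proof
  assume "(AA_root a)\<^sup>2 = 1"
  then have "exp (2 * (\<i> * of_real pi / of_nat a)) = (1 :: complex)"
    by (simp only: AA_root_def exp_double)
  \<comment> \<open>Comparing imaginary parts, 2 pi / a would be an integer multiple of 2 pi, which
    fails for a \<ge> 2.\<close>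
  then obtain l :: int where "Im (2 * (\<i> * of_real pi / of_nat a)) = of_int (2 * l) * pi"
    by (auto simp: exp_eq_1)
  then have "real_of_int (l * int a) = of_int 1"
    using assms by (simp add: field_simps)
  then have "l * int a = 1"
    by (simp only: of_int_eq_iff)
  then show False
    using assms by (simp add: zmult_eq_1_iff)
qed

lemma group_GL2: "group (GL2 UNIV)"
proof (rule groupI)
  fix A B C assume *: "A \<in> carrier (GL2 UNIV)" "B \<in> carrier (GL2 UNIV)"
  show "A \<otimes>\<^bsub>GL2 UNIV\<^esub> B \<in> carrier (GL2 UNIV)"
    using * by (simp add: GL2_def invertible_mult)
  show "A \<otimes>\<^bsub>GL2 UNIV\<^esub> B \<otimes>\<^bsub>GL2 UNIV\<^esub> C = A \<otimes>\<^bsub>GL2 UNIV\<^esub> (B \<otimes>\<^bsub>GL2 UNIV\<^esub> C)"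
    by (simp add: GL2_def matrix_mul_assoc)
next
  fix A assume "A \<in> carrier (GL2 UNIV)"
  then show "\<exists>B\<in>carrier (GL2 UNIV). B \<otimes>\<^bsub>GL2 UNIV\<^esub> A = \<one>\<^bsub>GL2 UNIV\<^esub>"
    by (auto simp: GL2_def invertible_def)
qed (auto simp: GL2_def invertible_def)

text \<open>The second row imposes no condition, and the first row determines the first coordinate
  from the second because the diagonal entry differs from 1.\<close>

lemma fixed_AA_S:
  assumes "a \<ge> 2"
  shows "AA_S a q *v y = y \<longleftrightarrow> y = y $ 2 *s vector [q / (1 - (AA_root a)\<^sup>2), 1]"
  using AA_root_square_neq_1[OF assms]
  by (auto simp: AA_S_def matrix_vector_mult_def vec_eq_iff forall_2 sum_2 field_simps)

text \<open>\<open>P\<close> carries the fixed line of \<open>AA_S a q\<close> onto that of the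
  conjugate, and \<open>pow\<close> makes the order finite.\<close>

lemma is_reflection_conj_AA_S:
  assumes a: "a \<ge> 2" and P: "P \<in> carrier (GL2 UNIV)" and A: "AA_S a q \<in> carrier (GL2 UNIV)"
    and pow: "AA_S a q [^]\<^bsub>GL2 UNIV\<^esub> a = \<one>\<^bsub>GL2 UNIV\<^esub>"
  shows "is_reflection (conj_by (GL2 UNIV) P (AA_S a q))"
proof -
  interpret G: group "GL2 UNIV" by (rule group_GL2)
  define Q where "Q = inv\<^bsub>GL2 UNIV\<^esub> P"
  let ?M = "conj_by (GL2 UNIV) P (AA_S a q)"
  let ?w = "vector [q / (1 - (AA_root a)\<^sup>2), 1] :: complex^2"
  have M: "?M = P ** AA_S a q ** Q"
    by (simp add: conj_by_def Q_def) (simp add: GL2_def)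
  have PQ: "P ** Q = mat 1" "Q ** P = mat 1"
    using G.r_inv[OF P] G.l_inv[OF P] unfolding Q_def[symmetric] by (simp_all add: GL2_def)
  have PQv: "P *v (Q *v v) = v" "Q *v (P *v v) = v" for v
    by (simp_all add: matrix_vector_mul_assoc PQ)
  have "?M *v v = v \<longleftrightarrow> v \<in> vec.span {P *v ?w}" for v
  proof -
    have "?M *v v = v \<longleftrightarrow> P *v (AA_S a q *v (Q *v v)) = v"
      by (simp add: M matrix_vector_mul_assoc matrix_mul_assoc)
    also have "\<dots> \<longleftrightarrow> AA_S a q *v (Q *v v) = Q *v v"
      using PQv by metis
    also have "\<dots> \<longleftrightarrow> Q *v v = (Q *v v) $ 2 *s ?w"
      by (rule fixed_AA_S[OF a])
    \<comment> \<open>The second entry of \<open>?w\<close> is 1, so the coefficient of a multiple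
      of \<open>?w\<close> is its second coordinate.\<close>
    also have "\<dots> \<longleftrightarrow> (\<exists>c. Q *v v = c *s ?w)"
      by (metis vector_2(2) mult.right_neutral vector_smult_component)
    also have "\<dots> \<longleftrightarrow> (\<exists>c. v = c *s (P *v ?w))"
      by (metis PQv vector_scalar_commute)
    finally show ?thesis
      by (auto simp: vec.span_singleton)
  qed
  then have fixed: "{v. ?M *v v = v} = vec.span {P *v ?w}"
    by blast
  have "?w \<noteq> 0"
    by (metis vector_2(2) zero_index zero_neq_one)
  then have "P *v ?w \<noteq> 0"
    using PQv(2)[of ?w] by auto
  then have "vec.dim {v. ?M *v v = v} = 1"
    unfolding fixed by simp
  moreover have "?M [^]\<^bsub>GL2 UNIV\<^esub> a = \<one>\<^bsub>GL2 UNIV\<^esub>"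
    using P A by (simp add: G.conj_by_pow pow) (simp add: conj_by_def)
  ultimately show ?thesis
    unfolding is_reflection_def using a P A by (auto intro!: exI[of _ a])
qed

text \<open>Replacing \<open>K\<close> by all complex numbers keeps the product and gives access to
  the group laws of the full linear group.\<close>

lemma AA_rep_group_hom:
  assumes "AA_rep K a b c q r \<rho>"
  shows "group_hom (J_parent a b c) (GL2 UNIV) \<rho>"
proof -
  have "\<rho> \<in> hom (J_parent a b c) (GL2 UNIV)"
    using assms by (auto simp: AA_rep_def hom_def GL2_def)
  then show ?thesis
    using group_GL2 group_presented
    by (simp add: group_hom_def group_hom_axioms_def J_parent_def)
qed

theorem theorem1p1:
  fixes k n m :: nat
  assumes "k \<ge> 2" and "n \<ge> 2" and "m \<ge> 2" and "n < m" and "coprime n m"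
  shows "\<exists>f \<in> iso (toric_group k n m) (J_group k n m 1 n m).
           \<forall>K q r \<rho>. AA_rep K k n m q r \<rho> \<longrightarrow>
             (\<forall>i \<in> {1..n}. is_reflection (\<rho> (f (toric_gen k n m i))))"
proof -
  interpret toric_params k n m
    by unfold_locales (use assms in auto)
  show ?thesis
  proof (intro bexI[OF _ \<eta>_iso] allI impI ballI)
    fix K q r \<rho> i
    assume rep: "AA_rep K k n m q r \<rho>" and i: "i \<in> {1..n}"
    interpret \<rho>: group_hom J "GL2 UNIV" \<rho>
      by (rule AA_rep_group_hom[OF rep])
    have s: "\<rho> s = AA_S k q"
      using rep by (simp add: AA_rep_def)
    have "\<eta> (toric_gen k n m i) = conj_by J (t [^]\<^bsub>J\<^esub> (i - 1)) s"
      using \<eta>_gen[of i] i by (simp add: gen_def wrap_id)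
    \<comment> \<open>A homomorphism maps conjugates to conjugates, so every generator acts by a
      conjugate of the same matrix \<rho>(s).\<close>
    then have "\<rho> (\<eta> (toric_gen k n m i)) = conj_by (GL2 UNIV) (\<rho> (t [^]\<^bsub>J\<^esub> (i - 1))) (AA_S k q)"
      by (simp add: conj_by_def flip: s)
    moreover have "AA_S k q \<in> carrier (GL2 UNIV)"
      using \<rho>.hom_closed[of s] by (simp add: s)
    moreover have "AA_S k q [^]\<^bsub>GL2 UNIV\<^esub> k = \<one>\<^bsub>GL2 UNIV\<^esub>"
      using \<rho>.hom_nat_pow[of s k] by (simp add: J_gen_pow s)
    ultimately show "is_reflection (\<rho> (\<eta> (toric_gen k n m i)))"
      using is_reflection_conj_AA_S[OF assms(1)] by simp
  qed
qed

end
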